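(* Let $X$ be a non-empty compact metric space and let $(G_n)_{n\in\omega}$ be a sequence of minimal open covers of $X$ such that (1) $G_n$ consolidates $G_{n+1}$ for every $n\in\omega$; (2) $G_n\cap G_{n+1}=\emptyset$ for every $n\in\omega$; (3) $\lim_{n\to\infty}\max\{\operatorname{diam}(g):g\in G_n\}=0$, or equivalently every open cover of $X$ is refined by some $G_n$. Endow every $G_n$ with the edge relation $g\sqcap g'\Leftrightarrow g\cap g'\neq\emptyset$, and for $m\le n$ let $R^m_n=\{(g,h)\in G_m\times G_n:g\supseteq h\}$. Let $\mathbb{P}$ denote the poset $\bigcup_{n\in\omega}G_n$ ordered by inclusion. Then $(G_n,R^m_n)$ is an edge-faithful sequence in $\mathbf{B}$ with induced poset $\mathbb{P}$, $\mathbb{P}$ is a cap-basis of $X$, and hence $X$ is homeomorphic to $\mathsf{S}\mathbb{P}$. Moreover, the sequence $(G_n,R^m_n)$ is anti-injective and has an edge-witnessing and star-refining subsequence.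
   Context: Covers. A cover $C$ of a set is minimal if no $C\setminus\{c\}$, $c\in C$, is a cover. A cover $D$ refines a cover $C$ if each $d\in D$ is contained in some $c\in C$. A cover $C$ consolidates a cover $D$ if $D$ refines $C$ and each $c\in C$ equals $\bigcup\{d\in D:d\subseteq c\}$. Graphs and relations. A graph is a finite non-empty set $G$ with a reflexive symmetric relation $\sqcap$ (the edge relation). A relation $R\subseteq H\times G$ between graphs is viewed as a relation from $G$ to $H$; write $R(g)=\{h:(h,g)\in R\}$ and $R^{-1}(h)=\{g:(h,g)\in R\}$; $(c,a)\in Q\circ R$ iff $(c,b)\in Q$ and $(b,a)\in R$ for some $b$. $R$ is: edge-preserving if $(h,g),(h',g')\in R$ and $g\sqcap g'$ imply $h\sqcap h'$; co-bijective if $R(g)\ne\emptyset$ for all $g$ and for all $h\in H$ there is $g$ with $R(g)=\{h\}$; anti-injective if $|R^{-1}(h)|\ge2$ for all $h$; edge-witnessing if $h\sqcap h'$ implies there is $g$ with $(h,g),(h',g)\in R$; star-refining if for all $g\in G$ there is $h\in H$ with $\{g':g'\sqcap g\}\subseteq R^{-1}(h)$. $\mathbf{B}$ is the category of graphs with co-bijective edge-preserving relations as morphisms. Sequences. A sequence in $\mathbf{B}$ is a family $(G_n,R^m_n)_{m\le n\in\omega}$ with $R^m_n$ a morphism of $\mathbf{B}$ from $G_n$ to $G_m$, $R^n_n$ the identity and $R^l_m\circ R^m_n=R^l_n$ for $l\le m\le n$. It has a property of morphisms if $R^m_n$ has it for all $m<n$. A subsequence is $(G_{\phi(n)},R^{\phi(m)}_{\phi(n)})$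 for a strictly increasing $\phi:\omega\to\omega$. The induced poset is the disjoint union $\bigsqcup_nG_n$ (identified with the plain union if the $G_n$ are pairwise disjoint), where for $p\in G_n$, $q\in G_m$, $p\le q$ iff $m\le n$ and $(q,p)\in R^m_n$. The sequence is edge-faithful if for all $n$ and $g,h\in G_n$: $g\sqcap h$ iff $g,h$ have a common lower bound in the induced poset. Spectrum. In a poset $\mathbb{P}$, a band is a finite $B\subseteq\mathbb{P}$ such that every element of $\mathbb{P}$ is comparable to an element of $B$; a cap is a set $C\subseteq\mathbb P$ for which there is a band $B$ such that each $b\in B$ is $\le$ some $c\in C$; a selector is a subset of $\mathbb{P}$ meeting every cap. The spectrum $\mathsf{S}\mathbb{P}$ is the set of minimal selectors (with respect to inclusion) with the topology generated by the sets $p^\in=\{S\in\mathsf{S}\mathbb{P}:p\in S\}$, $p\in\mathbb{P}$. A basis $\mathbb{P}$ of non-empty open subsets of a space $X$, ordered by inclusion, is a cap-basis if the caps of $\mathbb{P}$ are exactly the covers of $X$ by elements of $\mathbb{P}$. *)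

theory Defs
  imports "HOL-Analysis.Analysis"
begin

section \<open>Covers\<close>

definition is_cover :: "'a set \<Rightarrow> 'a set set \<Rightarrow> bool" where
  "is_cover X C \<longleftrightarrow> \<Union>C = X"

definition minimal_cover :: "'a set \<Rightarrow> 'a set set \<Rightarrow> bool" where
  "minimal_cover X C \<longleftrightarrow> is_cover X C \<and> (\<forall>c\<in>C. \<not> is_cover X (C - {c}))"

definition open_cover :: "'a topology \<Rightarrow> 'a set set \<Rightarrow> bool" where
  "open_cover T C \<longleftrightarrow> (\<forall>c\<in>C. openin T c) \<and> is_cover (topspace T) C"

definition cover_refines :: "'a set set \<Rightarrow> 'a set set \<Rightarrow> bool" where
  "cover_refines D C \<longleftrightarrow> (\<forall>d\<in>D. \<exists>c\<in>C. d \<subseteq> c)"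

definition consolidates :: "'a set set \<Rightarrow> 'a set set \<Rightarrow> bool" where
  "consolidates C D \<longleftrightarrow> cover_refines D C \<and> (\<forall>c\<in>C. c = \<Union>{d \<in> D. d \<subseteq> c})"


section \<open>Graphs and relations\<close>

record 'v graph =
  verts :: "'v set"
  edges :: "('v \<times> 'v) set"

definition is_graph :: "'v graph \<Rightarrow> bool" where
  "is_graph G \<longleftrightarrow> finite (verts G) \<and> verts G \<noteq> {} \<and> edges G \<subseteq> verts G \<times> verts G
     \<and> refl_on (verts G) (edges G) \<and> sym (edges G)"

text \<open>A relation from \<open>G\<close> to \<open>H\<close> is a subset of \<open>H \<times> G\<close>, so pairs have the target vertex first.
  With this convention the composite \<open>Q \<circ> R\<close> is the relational product \<open>Q O R\<close>.\<close>

definition rel_image :: "('h \<times> 'g) set \<Rightarrow> 'g \<Rightarrow> 'h set" where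
  "rel_image R g = {h. (h, g) \<in> R}"

definition rel_preimage :: "('h \<times> 'g) set \<Rightarrow> 'h \<Rightarrow> 'g set" where
  "rel_preimage R h = {g. (h, g) \<in> R}"

text \<open>In all the following properties the first graph is the source and the second the target.\<close>

definition edge_preserving :: "'g graph \<Rightarrow> 'h graph \<Rightarrow> ('h \<times> 'g) set \<Rightarrow> bool" where
  "edge_preserving G H R \<longleftrightarrow>
     (\<forall>h g h' g'. (h, g) \<in> R \<and> (h', g') \<in> R \<and> (g, g') \<in> edges G \<longrightarrow> (h, h') \<in> edges H)"

definition co_bijective :: "'g graph \<Rightarrow> 'h graph \<Rightarrow> ('h \<times> 'g) set \<Rightarrow> bool" where
  "co_bijective G H R \<longleftrightarrow>
     (\<forall>g\<in>verts G. rel_image R g \<noteq> {}) \<and> (\<forall>h\<in>verts H. \<exists>g\<in>verts G. rel_image R g = {h})"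

definition anti_injective :: "'g graph \<Rightarrow> 'h graph \<Rightarrow> ('h \<times> 'g) set \<Rightarrow> bool" where
  "anti_injective G H R \<longleftrightarrow> (\<forall>h\<in>verts H. 2 \<le> card (rel_preimage R h))"

definition edge_witnessing :: "'g graph \<Rightarrow> 'h graph \<Rightarrow> ('h \<times> 'g) set \<Rightarrow> bool" where
  "edge_witnessing G H R \<longleftrightarrow>
     (\<forall>h h'. (h, h') \<in> edges H \<longrightarrow> (\<exists>g\<in>verts G. (h, g) \<in> R \<and> (h', g) \<in> R))"

definition star_refining :: "'g graph \<Rightarrow> 'h graph \<Rightarrow> ('h \<times> 'g) set \<Rightarrow> bool" where
  "star_refining G H R \<longleftrightarrow>
     (\<forall>g\<in>verts G. \<exists>h\<in>verts H. {g' \<in> verts G. (g', g) \<in> edges G} \<subseteq> rel_preimage R h)"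

definition B_morphism :: "'g graph \<Rightarrow> 'h graph \<Rightarrow> ('h \<times> 'g) set \<Rightarrow> bool" where
  "B_morphism G H R \<longleftrightarrow>
     R \<subseteq> verts H \<times> verts G \<and> co_bijective G H R \<and> edge_preserving G H R"


section \<open>Sequences of graphs\<close>

text \<open>\<open>R m n\<close> is the bonding relation from \<open>G n\<close> to \<open>G m\<close>; only the values for \<open>m \<le> n\<close> matter.\<close>

definition B_sequence ::
  "(nat \<Rightarrow> 'v graph) \<Rightarrow> (nat \<Rightarrow> nat \<Rightarrow> ('v \<times> 'v) set) \<Rightarrow> bool" where
  "B_sequence G R \<longleftrightarrow>
     (\<forall>n. is_graph (G n)) \<and>
     (\<forall>m n. m \<le> n \<longrightarrow> B_morphism (G n) (G m) (R m n)) \<and>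
     (\<forall>n. R n n = Id_on (verts (G n))) \<and>
     (\<forall>l m n. l \<le> m \<and> m \<le> n \<longrightarrow> R l m O R m n = R l n)"

definition seq_has ::
  "('v graph \<Rightarrow> 'v graph \<Rightarrow> ('v \<times> 'v) set \<Rightarrow> bool) \<Rightarrow>
   (nat \<Rightarrow> 'v graph) \<Rightarrow> (nat \<Rightarrow> nat \<Rightarrow> ('v \<times> 'v) set) \<Rightarrow> bool" where
  "seq_has P G R \<longleftrightarrow> (\<forall>m n. m < n \<longrightarrow> P (G n) (G m) (R m n))"

text \<open>The disjoint union of the vertex sets is formed by tagging each vertex with its index.\<close>

definition induced_carrier :: "(nat \<Rightarrow> 'v graph) \<Rightarrow> (nat \<times> 'v) set" where
  "induced_carrier G = (SIGMA n:UNIV. verts (G n))"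

definition induced_le ::
  "(nat \<Rightarrow> nat \<Rightarrow> ('v \<times> 'v) set) \<Rightarrow> nat \<times> 'v \<Rightarrow> nat \<times> 'v \<Rightarrow> bool" where
  "induced_le R p q \<longleftrightarrow> fst q \<le> fst p \<and> (snd q, snd p) \<in> R (fst q) (fst p)"

definition edge_faithful ::
  "(nat \<Rightarrow> 'v graph) \<Rightarrow> (nat \<Rightarrow> nat \<Rightarrow> ('v \<times> 'v) set) \<Rightarrow> bool" where
  "edge_faithful G R \<longleftrightarrow>
     (\<forall>n. \<forall>g\<in>verts (G n). \<forall>h\<in>verts (G n).
        (g, h) \<in> edges (G n) \<longleftrightarrow>
        (\<exists>x\<in>induced_carrier G. induced_le R x (n, g) \<and> induced_le R x (n, h)))"

text \<open>The induced poset is \<open>(P, le)\<close> under the identification of the disjoint union with the plain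
  union, i.e. forgetting the index is an order isomorphism. Bijectivity says that the vertex sets
  are pairwise disjoint with union \<open>P\<close>.\<close>

definition has_induced_poset ::
  "(nat \<Rightarrow> 'v graph) \<Rightarrow> (nat \<Rightarrow> nat \<Rightarrow> ('v \<times> 'v) set) \<Rightarrow>
   'v set \<Rightarrow> ('v \<Rightarrow> 'v \<Rightarrow> bool) \<Rightarrow> bool" where
  "has_induced_poset G R P le \<longleftrightarrow>
     bij_betw snd (induced_carrier G) P \<and>
     (\<forall>x\<in>induced_carrier G. \<forall>y\<in>induced_carrier G.
        induced_le R x y \<longleftrightarrow> le (snd x) (snd y))"


section \<open>Spectrum of a poset\<close>

definition band :: "'p set \<Rightarrow> ('p \<Rightarrow> 'p \<Rightarrow> bool) \<Rightarrow> 'p set \<Rightarrow> bool" where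
  "band P le B \<longleftrightarrow> finite B \<and> B \<subseteq> P \<and> (\<forall>p\<in>P. \<exists>b\<in>B. le p b \<or> le b p)"

definition cap :: "'p set \<Rightarrow> ('p \<Rightarrow> 'p \<Rightarrow> bool) \<Rightarrow> 'p set \<Rightarrow> bool" where
  "cap P le C \<longleftrightarrow> C \<subseteq> P \<and> (\<exists>B. band P le B \<and> (\<forall>b\<in>B. \<exists>c\<in>C. le b c))"

definition selector :: "'p set \<Rightarrow> ('p \<Rightarrow> 'p \<Rightarrow> bool) \<Rightarrow> 'p set \<Rightarrow> bool" where
  "selector P le S \<longleftrightarrow> S \<subseteq> P \<and> (\<forall>C. cap P le C \<longrightarrow> S \<inter> C \<noteq> {})"

definition spectrum :: "'p set \<Rightarrow> ('p \<Rightarrow> 'p \<Rightarrow> bool) \<Rightarrow> 'p set set" where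
  "spectrum P le = {S. selector P le S \<and> (\<forall>S'. selector P le S' \<and> S' \<subseteq> S \<longrightarrow> S' = S)}"

text \<open>The whole spectrum is added to the generating family because \<open>topology_generated_by\<close> takes
  the union of the family as the underlying space, which could miss an empty minimal selector.\<close>

definition spectrum_topology :: "'p set \<Rightarrow> ('p \<Rightarrow> 'p \<Rightarrow> bool) \<Rightarrow> 'p set topology" where
  "spectrum_topology P le =
     topology_generated_by
       (insert (spectrum P le) ((\<lambda>p. {S \<in> spectrum P le. p \<in> S}) ` P))"

lemma topspace_spectrum_topology [simp]: "topspace (spectrum_topology P le) = spectrum P le"
  by (auto simp: spectrum_topology_def)

definition cap_basis :: "'a topology \<Rightarrow> 'a set set \<Rightarrow> bool" where
  "cap_basis T P \<longleftrightarrow>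
     {} \<notin> P \<and> openin T = arbitrary union_of (\<lambda>p. p \<in> P) \<and>
     (\<forall>C. cap P (\<subseteq>) C \<longleftrightarrow> C \<subseteq> P \<and> is_cover (topspace T) C)"


section \<open>Graphs from covers\<close>

definition overlap_graph :: "'a set set \<Rightarrow> 'a set graph" where
  "overlap_graph C = \<lparr>verts = C, edges = {(g, g'). g \<in> C \<and> g' \<in> C \<and> g \<inter> g' \<noteq> {}}\<rparr>"

definition containment :: "'a set set \<Rightarrow> 'a set set \<Rightarrow> ('a set \<times> 'a set) set" where
  "containment C D = {(g, h). g \<in> C \<and> h \<in> D \<and> h \<subseteq> g}"

end

theory Submission
  imports Defs
begin

text \<open>Every member of a minimal cover has a private point, lying in no other member.  Following a
  private point through the covers shows that a set in \<open>C n\<close> contained in a set of \<open>C m\<close> factors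
  through each intermediate cover, and that inclusion can only go from later to earlier covers; this
  gives the morphism and poset statements.  A band is finite, so it is refined by some \<open>C n\<close>, and
  hence caps are covers; conversely every cover is refined by the band \<open>C n\<close> for large \<open>n\<close>.  A set
  \<open>S\<close> of basis members containing no \<open>{p. x \<in> p}\<close> misses a cover, namely its complement, so the
  minimal selectors are exactly these point filters, and \<open>x \<mapsto> {p. x \<in> p}\<close> is the homeomorphism.\<close>

section \<open>Minimal covers\<close>

lemma minimal_cover_private_point:
  assumes "minimal_cover X C" "c \<in> C"
  obtains x where "x \<in> c" "\<And>d. d \<in> C \<Longrightarrow> x \<in> d \<Longrightarrow> d = c"
proof -
  have "\<Union>(C - {c}) \<noteq> \<Union>C" using assms unfolding minimal_cover_def is_cover_def by simp
  then obtain x where "x \<in> \<Union>C" "x \<notin> \<Union>(C - {c})" by blast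
  then show thesis by (intro that[of x]) auto
qed

text \<open>The private point of \<open>c\<close> also lies in \<open>d\<close>.\<close>

lemma minimal_cover_antichain:
  assumes "minimal_cover X C" "c \<in> C" "d \<in> C" "c \<subseteq> d"
  shows "c = d"
proof -
  obtain x where "x \<in> c" "\<And>d. d \<in> C \<Longrightarrow> x \<in> d \<Longrightarrow> d = c"
    using minimal_cover_private_point[OF assms(1,2)] by metis
  then show ?thesis using assms(3,4) by blast
qed

text \<open>A finite subcover must already contain every member, because the private point of a
  member is covered by that member alone.\<close>

lemma minimal_cover_finite:
  assumes "compact X" "open_cover (top_of_set X) C" "minimal_cover X C"
  shows "finite C"
proof -
  have "compactin (top_of_set X) X"
    using assms(1) by (simp add: compactin_subtopology)
  then obtain F where F: "finite F" "F \<subseteq> C" "X \<subseteq> \<Union>F"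
    using assms(2) unfolding compactin_def open_cover_def is_cover_def
    by (metis topspace_euclidean_subtopology order_refl)
  have "C \<subseteq> F"
  proof
    fix c assume "c \<in> C"
    then obtain x where "x \<in> c" "\<And>d. d \<in> C \<Longrightarrow> x \<in> d \<Longrightarrow> d = c"
      using minimal_cover_private_point[OF assms(3)] by metis
    moreover have "x \<in> X"
      using \<open>x \<in> c\<close> \<open>c \<in> C\<close> assms(3) unfolding minimal_cover_def is_cover_def by blast
    ultimately show "c \<in> F" using F by blast
  qed
  then show ?thesis using F(1) finite_subset by blast
qed

lemma consolidates_trans:
  assumes "consolidates A B" "consolidates B C"
  shows "consolidates A C"
  unfolding consolidates_def cover_refines_def
proof (intro conjI ballI)
  fix c assume "c \<in> C"
  then show "\<exists>a\<in>A. c \<subseteq> a"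
    using assms unfolding consolidates_def cover_refines_def by (meson order_trans)
next
  fix a assume a: "a \<in> A"
  show "a = \<Union>{c \<in> C. c \<subseteq> a}"
  proof
    show "a \<subseteq> \<Union>{c \<in> C. c \<subseteq> a}"
    proof
      fix x assume "x \<in> a"
      then obtain b where b: "b \<in> B" "b \<subseteq> a" "x \<in> b"
        using a assms(1) unfolding consolidates_def by blast
      then obtain c where "c \<in> C" "c \<subseteq> b" "x \<in> c"
        using assms(2) unfolding consolidates_def by blast
      then show "x \<in> \<Union>{c \<in> C. c \<subseteq> a}" using b by blast
    qed
  qed blast
qed

lemma consolidates_refl: "consolidates A A"
  unfolding consolidates_def cover_refines_def by blast

lemma consolidatesE:
  assumes "consolidates A B" "a \<in> A" "x \<in> a"
  obtains b where "b \<in> B" "b \<subseteq> a" "x \<in> b"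
proof -
  have "x \<in> \<Union>{b \<in> B. b \<subseteq> a}" using assms unfolding consolidates_def by simp
  then show thesis using that by auto
qed


section \<open>Sequences of consolidating covers\<close>

text \<open>This collects the combinatorial part of the argument; compactness enters only through
  finiteness of the covers.\<close>

locale consolidating_covers =
  fixes X :: "'a set" and C :: "nat \<Rightarrow> 'a set set"
  assumes nonempty: "X \<noteq> {}"
    and finite_cover: "\<And>n. finite (C n)"
    and minimal: "\<And>n. minimal_cover X (C n)"
    and consolidates_Suc: "\<And>n. consolidates (C n) (C (Suc n))"
    and disjoint_Suc: "\<And>n. C n \<inter> C (Suc n) = {}"
begin

abbreviation "P \<equiv> \<Union>n. C n"

abbreviation "G \<equiv> \<lambda>n. overlap_graph (C n)"

abbreviation "R \<equiv> \<lambda>m n. containment (C m) (C n)"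

lemma union_cover: "\<Union>(C n) = X"
  using minimal[of n] unfolding minimal_cover_def is_cover_def by simp

lemma member_subset: "c \<in> C n \<Longrightarrow> c \<subseteq> X"
  using union_cover[of n] by auto

lemma cover_nonempty: "C n \<noteq> {}"
  using union_cover[of n] nonempty by auto

lemma member_nonempty: "c \<in> C n \<Longrightarrow> c \<noteq> {}"
  using minimal_cover_private_point[OF minimal] by (metis empty_iff)

lemma consolidates_le: "m \<le> n \<Longrightarrow> consolidates (C m) (C n)"
proof (induction rule: dec_induct)
  case (step n)
  then show ?case using consolidates_trans consolidates_Suc by metis
qed (rule consolidates_refl)

lemma refines_le:
  assumes "m \<le> n" "d \<in> C n"
  obtains c where "c \<in> C m" "d \<subseteq> c"
  using consolidates_le[OF assms(1)] assms(2) that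
  unfolding consolidates_def cover_refines_def by meson

text \<open>A private point \<open>x\<close> of \<open>h\<close> selects \<open>k\<close>:
  consolidation gives \<open>k\<close> around \<open>x\<close> inside \<open>g\<close>, then a
  member \<open>e\<close> of \<open>C n\<close> around \<open>x\<close> inside \<open>k\<close>, and
  privacy forces \<open>e = h\<close>.\<close>

lemma interpolate:
  assumes "l \<le> m" "m \<le> n" "g \<in> C l" "h \<in> C n" "h \<subseteq> g"
  obtains k where "k \<in> C m" "h \<subseteq> k" "k \<subseteq> g"
proof -
  obtain x where x: "x \<in> h" "\<And>d. d \<in> C n \<Longrightarrow> x \<in> d \<Longrightarrow> d = h"
    using minimal_cover_private_point[OF minimal assms(4)] by metis
  obtain k where k: "k \<in> C m" "k \<subseteq> g" "x \<in> k"
    using consolidatesE[OF consolidates_le[OF assms(1)] assms(3)] x assms(5) by blast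
  obtain e where "e \<in> C n" "e \<subseteq> k" "x \<in> e"
    using consolidatesE[OF consolidates_le[OF assms(2)] k(1,3)] by metis
  then show thesis using that k x by blast
qed

text \<open>Disjointness passes from consecutive levels to all: a set common to levels
  \<open>m\<close> and \<open>n\<close>, interpolated between itself and itself, would also belong
  to level \<open>Suc m\<close>.\<close>

lemma disjoint_less:
  assumes "m < n" shows "C m \<inter> C n = {}"
proof (rule ccontr)
  assume "C m \<inter> C n \<noteq> {}"
  then obtain c where c: "c \<in> C m" "c \<in> C n" by blast
  then obtain k where "k \<in> C (Suc m)" "c \<subseteq> k" "k \<subseteq> c"
    using interpolate[of m "Suc m" n c c] assms by auto
  then have "c = k" by blast
  then show False using disjoint_Suc[of m] c \<open>k \<in> C (Suc m)\<close> by blast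
qed

text \<open>Otherwise \<open>q\<close> comes from a later level and lies in some \<open>r\<close> of
  \<open>C m\<close>; the antichain property collapses \<open>p \<subseteq> q \<subseteq> r\<close>
  to equalities, against disjointness of levels.\<close>

lemma subset_imp_level_ge:
  assumes "p \<in> C m" "q \<in> C n" "p \<subseteq> q" shows "n \<le> m"
proof (rule ccontr)
  assume "\<not> n \<le> m"
  then have mn: "m < n" by simp
  then obtain r where r: "r \<in> C m" "q \<subseteq> r" using refines_le[of m n q] assms by auto
  then have "p = r" using minimal_cover_antichain[OF minimal assms(1)] assms(3) by blast
  then have "p = q" using assms(3) r(2) by blast
  then show False using disjoint_less[OF mn] assms by blast
qed

section \<open>Overlap graphs, their morphisms and the induced poset\<close>

lemma is_graph_overlap: "is_graph (G n)"
  unfolding is_graph_def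
proof (intro conjI)
  show "finite (verts (G n))" "verts (G n) \<noteq> {}"
    using finite_cover cover_nonempty by (simp_all add: overlap_graph_def)
  show "edges (G n) \<subseteq> verts (G n) \<times> verts (G n)"
    by (auto simp: overlap_graph_def)
  show "refl_on (verts (G n)) (edges (G n))"
    using member_nonempty[of _ n] by (simp add: overlap_graph_def refl_on_def)
  show "sym (edges (G n))"
    by (simp add: overlap_graph_def sym_def Int_commute)
qed

lemma B_morphism_containment:
  assumes "m \<le> n" shows "B_morphism (G n) (G m) (R m n)"
  unfolding B_morphism_def co_bijective_def
proof (intro conjI ballI)
  show "R m n \<subseteq> verts (G m) \<times> verts (G n)"
    by (auto simp: containment_def overlap_graph_def)
  show "edge_preserving (G n) (G m) (R m n)"
    unfolding containment_def overlap_graph_def edge_preserving_def by simp blast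
next
  fix g assume "g \<in> verts (G n)"
  then have "g \<in> C n" by (simp add: overlap_graph_def)
  then show "rel_image (R m n) g \<noteq> {}"
    using refines_le[OF assms, of g] by (auto simp: rel_image_def containment_def)
next
  fix h assume "h \<in> verts (G m)"
  then have h: "h \<in> C m" by (simp add: overlap_graph_def)
  then obtain x where x: "x \<in> h" "\<And>d. d \<in> C m \<Longrightarrow> x \<in> d \<Longrightarrow> d = h"
    using minimal_cover_private_point[OF minimal] by metis
  \<comment> \<open>Any member of \<open>C m\<close> containing this \<open>g\<close> contains the
    private point \<open>x\<close>, hence is \<open>h\<close>.\<close>
  then obtain g where g: "g \<in> C n" "g \<subseteq> h" "x \<in> g"
    using consolidatesE[OF consolidates_le[OF assms] h] by metis
  then have "rel_image (R m n) g = {h}"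
    unfolding rel_image_def containment_def using x(2) h by blast
  then show "\<exists>g\<in>verts (G n). rel_image (R m n) g = {h}"
    using g by (auto simp: overlap_graph_def)
qed

text \<open>The identity axiom is the antichain property of a single cover; the hard inclusion in
  the composition axiom is the factorisation provided by \<open>interpolate\<close>.\<close>

lemma B_sequence_covers: "B_sequence G R"
  unfolding B_sequence_def
proof (intro conjI allI impI)
  show "R n n = Id_on (verts (G n))" for n
    unfolding containment_def overlap_graph_def Id_on_def
    using minimal_cover_antichain[OF minimal, of _ n] by fastforce
  show "R l m O R m n = R l n" if le: "l \<le> m \<and> m \<le> n" for l m n
  proof
    show "R l m O R m n \<subseteq> R l n" by (auto simp: containment_def)
    show "R l n \<subseteq> R l m O R m n"
    proof
      fix z assume "z \<in> R l n"
      then obtain g h where z: "z = (g, h)" "g \<in> C l" "h \<in> C n" "h \<subseteq> g"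
        by (auto simp: containment_def)
      then obtain k where "k \<in> C m" "h \<subseteq> k" "k \<subseteq> g" 
        using interpolate[of l m n g h] le by metis
      then show "z \<in> R l m O R m n" using z by (auto simp: containment_def)
    qed
  qed
qed (auto intro: is_graph_overlap B_morphism_containment)

text \<open>Inclusion bounds levels, so a set determines its level and the index condition in
  \<open>induced_le\<close> is automatic from inclusion.\<close>

lemma has_induced_poset_covers: "has_induced_poset G R P (\<subseteq>)"
  unfolding has_induced_poset_def
proof (intro conjI ballI)
  have carrier: "induced_carrier G = (SIGMA n:UNIV. C n)"
    by (simp add: induced_carrier_def overlap_graph_def)
  have "inj_on snd (induced_carrier G)"
  proof (rule inj_onI)
    fix x y assume "x \<in> induced_carrier G" "y \<in> induced_carrier G" and eq: "snd x = snd y"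
    then have "snd x \<in> C (fst x)" "snd y \<in> C (fst y)" by (auto simp: carrier)
    then have "fst x = fst y"
      using eq subset_imp_level_ge[of "snd x" "fst x" "snd y" "fst y"]
        subset_imp_level_ge[of "snd y" "fst y" "snd x" "fst x"] by simp
    then show "x = y" using eq by (rule prod_eqI)
  qed
  moreover have "snd ` induced_carrier G = P" by (simp add: carrier snd_image_Sigma)
  ultimately show "bij_betw snd (induced_carrier G) P" by (rule bij_betw_imageI)
  show "induced_le R x y \<longleftrightarrow> snd x \<subseteq> snd y"
    if "x \<in> induced_carrier G" "y \<in> induced_carrier G" for x y
    using that subset_imp_level_ge[of "snd x" "fst x" "snd y" "fst y"]
    by (auto simp: induced_le_def carrier containment_def)
qed

text \<open>By consolidation \<open>h\<close> is the union of the members of \<open>C n\<close>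
  inside it. With none, \<open>h\<close> would be empty; with just one, \<open>h\<close> would
  itself belong to \<open>C n\<close>, against disjointness.\<close>

lemma seq_has_anti_injective: "seq_has anti_injective G R"
  unfolding seq_has_def anti_injective_def
proof (intro allI impI ballI)
  fix m n h assume mn: "m < n" and "h \<in> verts (G m)"
  then have h: "h \<in> C m" by (simp add: overlap_graph_def)
  let ?D = "{g \<in> C n. g \<subseteq> h}"
  have eq: "h = \<Union>?D"
    using consolidates_le[of m n] mn h unfolding consolidates_def by auto
  have "card ?D \<noteq> 0"
    using eq member_nonempty[OF h] finite_cover[of n] by auto
  moreover have "card ?D \<noteq> 1"
  proof
    assume "card ?D = 1"
    then obtain d where "?D = {d}" by (rule card_1_singletonE)
    then have "h \<in> C n" using eq by auto
    then show False using h disjoint_less[OF mn] by blast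
  qed
  moreover have "rel_preimage (R m n) h = ?D"
    using h by (auto simp: rel_preimage_def containment_def)
  ultimately show "2 \<le> card (rel_preimage (R m n) h)" by auto
qed

section \<open>Bands, caps and covers\<close>

lemma band_level: "band P (\<subseteq>) (C n)"
  unfolding band_def
proof (intro conjI ballI)
  fix p assume "p \<in> P"
  then obtain m where m: "p \<in> C m" by blast
  \<comment> \<open>A set from level at most \<open>n\<close> contains a member of
    \<open>C n\<close> by consolidation; one from a later level lies in such a member by
    refinement.\<close>
  show "\<exists>b\<in>C n. p \<subseteq> b \<or> b \<subseteq> p"
  proof (cases "m \<le> n")
    case True
    obtain x where "x \<in> p" using member_nonempty[OF m] by blast
    then show ?thesis using consolidatesE[OF consolidates_le[OF True] m] by metis
  next
    case False
    then show ?thesis using refines_le[of n m p] m by (metis nat_le_linear)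
  qed
qed (auto simp: finite_cover)

lemma band_refined:
  assumes "band P (\<subseteq>) B"
  obtains n where "cover_refines (C n) B"
proof -
  have B: "finite B" "\<forall>b\<in>B. \<exists>k. b \<in> C k"
    using assms unfolding band_def by auto
  then obtain lev where lev: "\<And>b. b \<in> B \<Longrightarrow> b \<in> C (lev b)" by metis
  \<comment> \<open>The strict bound excludes \<open>b \<subseteq> p\<close> for \<open>p\<close> in
    \<open>C n\<close>, so comparability with the band can only mean
    \<open>p \<subseteq> b\<close>.\<close>
  obtain n where n: "\<And>b. b \<in> B \<Longrightarrow> lev b < n"
    using finite_nat_set_iff_bounded[of "lev ` B"] B(1) by auto
  have "cover_refines (C n) B"
    unfolding cover_refines_def
  proof
    fix p assume p: "p \<in> C n"
    then obtain b where b: "b \<in> B" "p \<subseteq> b \<or> b \<subseteq> p"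
      using assms unfolding band_def by blast
    then show "\<exists>b\<in>B. p \<subseteq> b"
      using subset_imp_level_ge[OF lev[OF b(1)] p] n[OF b(1)] by auto
  qed
  then show thesis by (rule that)
qed

lemma cap_imp_cover:
  assumes "cap P (\<subseteq>) D" shows "is_cover X D"
proof -
  obtain B where B: "band P (\<subseteq>) B" "\<forall>b\<in>B. \<exists>d\<in>D. b \<subseteq> d" and D: "D \<subseteq> P"
    using assms unfolding cap_def by blast
  obtain n where "cover_refines (C n) B" using band_refined[OF B(1)] .
  then have "\<Union>(C n) \<subseteq> \<Union>D" using B(2) unfolding cover_refines_def by fastforce
  moreover have "\<Union>D \<subseteq> X" using D union_cover by blast
  ultimately show ?thesis unfolding is_cover_def using union_cover by blast
qed

end


section \<open>Vanishing mesh\<close>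

text \<open>Vanishing mesh in terms of distances, without suprema or maxima. It links the diameter
  condition with the refinement condition.\<close>

definition fine_covers :: "(nat \<Rightarrow> 'a::metric_space set set) \<Rightarrow> bool" where
  "fine_covers C \<longleftrightarrow> (\<forall>e>0. \<exists>N. \<forall>n\<ge>N. \<forall>c\<in>C n. \<forall>x\<in>c. \<forall>y\<in>c. dist x y < e)"

locale compact_consolidating_covers = consolidating_covers X C
  for X :: "'a::metric_space set" and C +
  assumes compact: "compact X"
    and open_member: "\<And>n c. c \<in> C n \<Longrightarrow> openin (top_of_set X) c"
begin

lemma fine_iff_mesh: "fine_covers C \<longleftrightarrow> (\<lambda>n. Max (diameter ` C n)) \<longlonglongrightarrow> 0"
proof
  \<comment> \<open>\<open>diameter\<close> is a supremum of reals and dominates the distances only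
    on bounded sets.\<close>
  have bdd: "bounded c" if "c \<in> C n" for c n
    using bounded_subset[OF compact_imp_bounded[OF compact] member_subset[OF that]] .
  have fin: "finite (diameter ` C n)" "diameter ` C n \<noteq> {}" for n
    using finite_cover cover_nonempty by auto
  show "fine_covers C" if lim: "(\<lambda>n. Max (diameter ` C n)) \<longlonglongrightarrow> 0"
    unfolding fine_covers_def
  proof (intro allI impI)
    fix e :: real assume "e > 0"
    then obtain N where N: "\<And>n. n \<ge> N \<Longrightarrow> \<bar>Max (diameter ` C n)\<bar> < e"
      using LIMSEQ_D[OF lim, of e] by auto
    have "dist x y < e" if "n \<ge> N" "c \<in> C n" "x \<in> c" "y \<in> c" for n c x y
    proof -
      have "dist x y \<le> diameter c" using diameter_bounded_bound[OF bdd[OF that(2)] that(3,4)] .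
      also have "\<dots> \<le> Max (diameter ` C n)" using fin that(2) by auto
      finally show ?thesis using N[OF that(1)] by auto
    qed
    then show "\<exists>N. \<forall>n\<ge>N. \<forall>c\<in>C n. \<forall>x\<in>c. \<forall>y\<in>c. dist x y < e" by blast
  qed
  show "(\<lambda>n. Max (diameter ` C n)) \<longlonglongrightarrow> 0" if fine: "fine_covers C"
  proof (rule LIMSEQ_I)
    fix r :: real assume r: "r > 0"
    \<comment> \<open>Half of \<open>r\<close> leaves room, since taking the supremum weakens a
      strict bound to a non-strict one.\<close>
    then obtain N where N: "\<And>n c x y. n \<ge> N \<Longrightarrow> c \<in> C n \<Longrightarrow> x \<in> c \<Longrightarrow> y \<in> c \<Longrightarrow> dist x y < r / 2"
      using fine unfolding fine_covers_def by (meson half_gt_zero)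
    have "norm (Max (diameter ` C n) - 0) < r" if n: "n \<ge> N" for n
    proof -
      have "diameter c \<le> r / 2" if "c \<in> C n" for c
      proof -
        have "(SUP (x, y)\<in>c \<times> c. dist x y) \<le> r / 2"
          using N[OF n that] member_nonempty[OF that]
          by (intro cSUP_least) (auto intro: less_imp_le)
        then show ?thesis using r by (simp add: diameter_def)
      qed
      then have "Max (diameter ` C n) \<le> r / 2"
        using fin by (intro Max.boundedI) auto
      moreover have "0 \<le> Max (diameter ` C n)"
        using Max_in[OF fin, of n] diameter_ge_0[OF bdd] by auto
      ultimately show ?thesis using r by auto
    qed
    then show "\<exists>N. \<forall>n\<ge>N. norm (Max (diameter ` C n) - 0) < r" by blast
  qed
qed

text \<open>The members of \<open>U\<close> are only relatively open, so
  \<open>Heine_Borel_lemma\<close> is applied to all open \<open>T\<close> whose trace on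
  \<open>X\<close> fits into a member of \<open>U\<close>.\<close>

lemma Lebesgue_number:
  assumes "open_cover (top_of_set X) U"
  obtains e where "e > 0" "\<And>x. x \<in> X \<Longrightarrow> \<exists>u\<in>U. X \<inter> ball x e \<subseteq> u"
proof -
  have "X \<subseteq> \<Union>{T. open T \<and> (\<exists>u\<in>U. X \<inter> T \<subseteq> u)}"
  proof
    fix x assume "x \<in> X"
    then obtain u where "u \<in> U" "x \<in> u" "openin (top_of_set X) u"
      using assms unfolding open_cover_def is_cover_def by auto
    then show "x \<in> \<Union>{T. open T \<and> (\<exists>u\<in>U. X \<inter> T \<subseteq> u)}"
      unfolding openin_open by auto
  qed
  then obtain e where "e > 0"
      and e: "\<forall>x\<in>X. \<exists>T\<in>{T. open T \<and> (\<exists>u\<in>U. X \<inter> T \<subseteq> u)}. ball x e \<subseteq> T"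
    using Heine_Borel_lemma[OF compact] by (metis (mono_tags, lifting) mem_Collect_eq)
  show thesis
  proof (rule that[OF \<open>e > 0\<close>])
    fix x assume "x \<in> X"
    then obtain T u where "u \<in> U" "X \<inter> T \<subseteq> u" "ball x e \<subseteq> T" using e by blast
    then show "\<exists>u\<in>U. X \<inter> ball x e \<subseteq> u" by blast
  qed
qed

text \<open>Forwards, a set whose distances stay below a Lebesgue number of \<open>U\<close> lies in
  a ball about any of its points. Backwards, some \<open>C N\<close> refines the cover by balls of
  radius \<open>e / 2\<close>, and all later covers refine \<open>C N\<close>.\<close>

lemma fine_iff_refines:
  "fine_covers C \<longleftrightarrow> (\<forall>U. open_cover (top_of_set X) U \<longrightarrow> (\<exists>n. cover_refines (C n) U))"
proof (intro iffI allI impI)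
  fix U assume fine: "fine_covers C" and U: "open_cover (top_of_set X) U"
  obtain e where e: "e > 0" "\<And>x. x \<in> X \<Longrightarrow> \<exists>u\<in>U. X \<inter> ball x e \<subseteq> u"
    using Lebesgue_number[OF U] by blast
  obtain n where n: "\<And>c x y. c \<in> C n \<Longrightarrow> x \<in> c \<Longrightarrow> y \<in> c \<Longrightarrow> dist x y < e"
    using fine e(1) unfolding fine_covers_def by (meson order_refl)
  have "cover_refines (C n) U"
    unfolding cover_refines_def
  proof
    fix c assume c: "c \<in> C n"
    then obtain x where x: "x \<in> c" using member_nonempty by blast
    have cX: "c \<subseteq> X" using c by (rule member_subset)
    then obtain u where "u \<in> U" "X \<inter> ball x e \<subseteq> u" using e(2) x by blast
    moreover have "c \<subseteq> X \<inter> ball x e" using n[OF c x] cX by auto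
    ultimately show "\<exists>u\<in>U. c \<subseteq> u" by blast
  qed
  then show "\<exists>n. cover_refines (C n) U" ..
next
  assume ref: "\<forall>U. open_cover (top_of_set X) U \<longrightarrow> (\<exists>n. cover_refines (C n) U)"
  show "fine_covers C"
    unfolding fine_covers_def
  proof (intro allI impI)
    fix e :: real assume e: "e > 0"
    have "open_cover (top_of_set X) ((\<lambda>x. X \<inter> ball x (e / 2)) ` X)"
      using e unfolding open_cover_def is_cover_def by (auto intro: openin_open_Int)
    then obtain N where N: "cover_refines (C N) ((\<lambda>x. X \<inter> ball x (e / 2)) ` X)"
      using ref by blast
    have "dist y z < e" if n: "n \<ge> N" "c \<in> C n" and yz: "y \<in> c" "z \<in> c" for n c y z
    proof -
      obtain d where d: "d \<in> C N" "c \<subseteq> d" using refines_le[OF n] .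
      then obtain x where "d \<subseteq> X \<inter> ball x (e / 2)"
        using N unfolding cover_refines_def by blast
      then have "c \<subseteq> ball x (e / 2)" using d by blast
      then have "dist x y < e / 2" "dist x z < e / 2" using yz by auto
      then show ?thesis by (rule dist_triangle_half_r)
    qed
    then show "\<exists>N. \<forall>n\<ge>N. \<forall>c\<in>C n. \<forall>x\<in>c. \<forall>y\<in>c. dist x y < e" by blast
  qed
qed

end

section \<open>Edge-faithfulness and the cap-basis\<close>

locale fine_compact_covers = compact_consolidating_covers +
  assumes fine: "fine_covers C"
begin

text \<open>Any member around \<open>x\<close> works once distances within members are below the
  radius of a ball about \<open>x\<close> inside \<open>u\<close>. Having this for all large
  \<open>n\<close> lets finitely many demands be met at one level.\<close>

lemma eventually_small_member:
  assumes "openin (top_of_set X) u" "x \<in> u"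
  shows "\<exists>N. \<forall>n\<ge>N. \<exists>c\<in>C n. x \<in> c \<and> c \<subseteq> u"
proof -
  obtain T where T: "open T" "u = X \<inter> T" using assms(1) unfolding openin_open by blast
  then obtain e where e: "e > 0" "ball x e \<subseteq> T" using assms(2) open_contains_ball by blast
  then obtain N where N: "\<And>n c y z. n \<ge> N \<Longrightarrow> c \<in> C n \<Longrightarrow> y \<in> c \<Longrightarrow> z \<in> c \<Longrightarrow> dist y z < e"
    using fine unfolding fine_covers_def by meson
  show ?thesis
  proof (intro exI allI impI)
    fix n assume n: "n \<ge> N"
    obtain c where c: "c \<in> C n" "x \<in> c" using T assms(2) union_cover[of n] by blast
    then have "c \<subseteq> ball x e" "c \<subseteq> X" using N[OF n] member_subset by auto
    then show "\<exists>c\<in>C n. x \<in> c \<and> c \<subseteq> u" using c T e by blast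
  qed
qed

lemma basis_member:
  assumes "openin (top_of_set X) u" "x \<in> u"
  shows "\<exists>p\<in>P. x \<in> p \<and> p \<subseteq> u"
proof -
  obtain N where "\<forall>n\<ge>N. \<exists>c\<in>C n. x \<in> c \<and> c \<subseteq> u"
    using eventually_small_member[OF assms] ..
  then have "\<exists>c\<in>C N. x \<in> c \<and> c \<subseteq> u" by simp
  then show ?thesis by blast
qed

lemma edge_faithful_covers: "edge_faithful G R"
  unfolding edge_faithful_def
proof (intro allI ballI)
  fix n g h assume "g \<in> verts (G n)" "h \<in> verts (G n)"
  then have gh: "g \<in> C n" "h \<in> C n" by (auto simp: overlap_graph_def)
  have "\<exists>x\<in>induced_carrier G. induced_le R x (n, g) \<and> induced_le R x (n, h)"
    if "y \<in> g" "y \<in> h" for y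
  proof -
    have "y \<in> g \<inter> h" using that by simp
    from eventually_small_member[OF openin_Int[OF gh[THEN open_member]] this]
    obtain N where "\<forall>k\<ge>N. \<exists>c\<in>C k. y \<in> c \<and> c \<subseteq> g \<inter> h" ..
    \<comment> \<open>The level has to be at least \<open>N\<close> for a small member to exist and
      at least \<open>n\<close> for it to lie below \<open>g\<close> and \<open>h\<close> in the
      induced order.\<close>
    then have "\<exists>c\<in>C (max n N). y \<in> c \<and> c \<subseteq> g \<inter> h" by simp
    then obtain c where "c \<in> C (max n N)" "c \<subseteq> g \<inter> h" by blast
    then show ?thesis using gh
      by (intro bexI[of _ "(max n N, c)"])
        (auto simp: induced_le_def containment_def induced_carrier_def overlap_graph_def)
  qed
  moreover have "g \<inter> h \<noteq> {}"
    if "x \<in> induced_carrier G" "induced_le R x (n, g)" "induced_le R x (n, h)" for x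
  proof -
    have "snd x \<in> C (fst x)" "snd x \<subseteq> g \<inter> h"
      using that by (auto simp: induced_le_def containment_def)
    then show ?thesis using member_nonempty[of "snd x" "fst x"] by auto
  qed
  moreover have "(g, h) \<in> edges (G n) \<longleftrightarrow> (\<exists>y. y \<in> g \<and> y \<in> h)"
    using gh by (auto simp: overlap_graph_def)
  ultimately show "(g, h) \<in> edges (G n) \<longleftrightarrow>
      (\<exists>x\<in>induced_carrier G. induced_le R x (n, g) \<and> induced_le R x (n, h))"
    by (metis disjoint_iff)
qed

lemma openin_iff_union: "openin (top_of_set X) u \<longleftrightarrow> (\<exists>U. U \<subseteq> P \<and> \<Union>U = u)"
proof
  assume "openin (top_of_set X) u"
  then have "\<Union>{p \<in> P. p \<subseteq> u} = u" using basis_member[of u] by blast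
  then show "\<exists>U. U \<subseteq> P \<and> \<Union>U = u" by (intro exI[of _ "{p \<in> P. p \<subseteq> u}"]) blast
next
  assume "\<exists>U. U \<subseteq> P \<and> \<Union>U = u"
  then obtain U where U: "U \<subseteq> P" "\<Union>U = u" by blast
  have "openin (top_of_set X) (\<Union>U)"
    by (rule openin_Union) (use U(1) open_member in auto)
  then show "openin (top_of_set X) u" using U(2) by simp
qed

text \<open>A cover by members of \<open>P\<close> is open, hence refined by some
  \<open>C n\<close>, and \<open>C n\<close> is a band.\<close>

lemma cap_iff_cover: "cap P (\<subseteq>) D \<longleftrightarrow> D \<subseteq> P \<and> is_cover X D"
proof
  show "cap P (\<subseteq>) D" if D: "D \<subseteq> P \<and> is_cover X D"
  proof -
    have "open_cover (top_of_set X) D"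
      using D open_member unfolding open_cover_def by auto
    then obtain n where "cover_refines (C n) D" using fine fine_iff_refines by blast
    then show ?thesis
      using D band_level[of n] unfolding cap_def cover_refines_def by blast
  qed
qed (auto simp: cap_imp_cover cap_def)

lemma cap_basis_covers: "cap_basis (top_of_set X) P"
  unfolding cap_basis_def
proof (intro conjI allI)
  show "{} \<notin> P" using member_nonempty by auto
  show "openin (top_of_set X) = arbitrary union_of (\<lambda>p. p \<in> P)"
    by (rule ext) (simp only: openin_iff_union union_of_def arbitrary_def Collect_mem_eq simp_thms)
qed (simp only: cap_iff_cover topspace_euclidean_subtopology)


subsection \<open>The spectrum\<close>

definition filter_at :: "'a \<Rightarrow> 'a set set" where
  "filter_at x = {p \<in> P. x \<in> p}"

lemma separating_member:
  assumes "x \<in> X" "y \<in> X" "x \<noteq> y"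
  shows "\<exists>p\<in>P. y \<in> p \<and> x \<notin> p"
proof -
  have "openin (top_of_set X) (X \<inter> - {x})" by (rule openin_open_Int) auto
  then show ?thesis using basis_member[of "X \<inter> - {x}" y] assms by blast
qed

lemma filter_at_selector: "x \<in> X \<Longrightarrow> selector P (\<subseteq>) (filter_at x)"
  unfolding selector_def filter_at_def cap_iff_cover is_cover_def by blast

text \<open>Given \<open>p\<close> around \<open>x\<close>, the members missing \<open>x\<close>
  cover all other points, so together with \<open>p\<close> they form a cap. A selector inside
  \<open>filter_at x\<close> can meet this cap only in \<open>p\<close>.\<close>

lemma filter_at_minimal:
  assumes x: "x \<in> X" and S: "selector P (\<subseteq>) S" "S \<subseteq> filter_at x"
  shows "S = filter_at x"
proof
  show "filter_at x \<subseteq> S"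
  proof
    fix p assume "p \<in> filter_at x"
    then have p: "p \<in> P" "x \<in> p" by (auto simp: filter_at_def)
    have "\<Union>(insert p {q \<in> P. x \<notin> q}) = X"
    proof
      show "\<Union>(insert p {q \<in> P. x \<notin> q}) \<subseteq> X" using p member_subset by blast
      show "X \<subseteq> \<Union>(insert p {q \<in> P. x \<notin> q})"
        using p separating_member[OF x] by blast
    qed
    then have "cap P (\<subseteq>) (insert p {q \<in> P. x \<notin> q})"
      using p unfolding cap_iff_cover is_cover_def by blast
    then have "S \<inter> insert p {q \<in> P. x \<notin> q} \<noteq> {}" using S(1) unfolding selector_def by blast
    then show "p \<in> S" using S(2) by (auto simp: filter_at_def)
  qed
qed fact

text \<open>If every point lay in some member outside \<open>S\<close>, then \<open>P - S\<close>
  would be a cap that \<open>S\<close> misses.\<close>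

lemma selector_contains_filter_at:
  assumes "selector P (\<subseteq>) S"
  shows "\<exists>x\<in>X. filter_at x \<subseteq> S"
proof (rule ccontr)
  assume "\<not> ?thesis"
  then have "\<forall>x\<in>X. \<exists>p\<in>P - S. x \<in> p" unfolding filter_at_def by blast
  moreover have "\<Union>(P - S) \<subseteq> X" using member_subset by blast
  ultimately have "cap P (\<subseteq>) (P - S)" unfolding cap_iff_cover is_cover_def by blast
  then show False using assms unfolding selector_def by blast
qed

lemma spectrum_eq: "spectrum P (\<subseteq>) = filter_at ` X"
proof (intro equalityI subsetI)
  fix S assume S: "S \<in> spectrum P (\<subseteq>)"
  then obtain x where "x \<in> X" "filter_at x \<subseteq> S"
    using selector_contains_filter_at unfolding spectrum_def by blast
  then show "S \<in> filter_at ` X" using S filter_at_selector unfolding spectrum_def by blast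
next
  fix S assume "S \<in> filter_at ` X"
  then show "S \<in> spectrum P (\<subseteq>)"
    using filter_at_selector filter_at_minimal unfolding spectrum_def by auto
qed

lemma inj_on_filter_at: "inj_on filter_at X"
proof (rule inj_onI, rule ccontr)
  fix x y assume xy: "x \<in> X" "y \<in> X" "x \<noteq> y" and eq: "filter_at x = filter_at y"
  obtain p where "p \<in> P" "y \<in> p" "x \<notin> p" using separating_member[OF xy] by blast
  then have "p \<in> filter_at y" "p \<notin> filter_at x" by (auto simp: filter_at_def)
  then show False using eq by simp
qed

text \<open>The generating open set given by \<open>p\<close> has preimage \<open>p\<close> and is
  the image of \<open>p\<close>. The first fact yields continuity; the second yields openness, as
  images commute with unions.\<close>

lemma homeomorphic_map_filter_at:
  "homeomorphic_map (top_of_set X) (spectrum_topology P (\<subseteq>)) filter_at"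
proof (rule bijective_open_imp_homeomorphic_map)
  have PX: "p \<subseteq> X" if "p \<in> P" for p using that member_subset by blast
  show "continuous_map (top_of_set X) (spectrum_topology P (\<subseteq>)) filter_at"
    unfolding spectrum_topology_def
  proof (rule continuous_on_generated_topo)
    fix U assume U: "U \<in> insert (spectrum P (\<subseteq>)) ((\<lambda>p. {S \<in> spectrum P (\<subseteq>). p \<in> S}) ` P)"
    \<comment> \<open>The first case is the whole spectrum, which \<open>spectrum_topology\<close>
      adds to the generating sets.\<close>
    then consider "U = filter_at ` X" | p where "p \<in> P" "U = {S \<in> filter_at ` X. p \<in> S}"
      unfolding spectrum_eq by blast
    then show "openin (top_of_set X) (filter_at -` U \<inter> topspace (top_of_set X))"
    proof cases
      case 1
      then have "filter_at -` U \<inter> X = X" by auto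
      then show ?thesis by simp
    next
      case 2
      then have "filter_at -` U \<inter> X = p" using PX[OF 2(1)] by (auto simp: filter_at_def)
      then show ?thesis using 2(1) open_member by auto
    qed
  qed (use spectrum_eq in auto)
  show "open_map (top_of_set X) (spectrum_topology P (\<subseteq>)) filter_at"
    unfolding open_map_def
  proof (intro allI impI)
    fix u assume "openin (top_of_set X) u"
    then obtain V where V: "V \<subseteq> P" "\<Union>V = u"
      unfolding openin_iff_union by blast
    have "openin (spectrum_topology P (\<subseteq>)) (filter_at ` p)" if p: "p \<in> V" for p
    proof -
      have "filter_at ` p = {S \<in> spectrum P (\<subseteq>). p \<in> S}"
        unfolding spectrum_eq using p V PX by (auto simp: filter_at_def)
      then show ?thesis using p V unfolding spectrum_topology_def
        by (intro topology_generated_by_Basis) auto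
    qed
    moreover have "filter_at ` u = \<Union>((`) filter_at ` V)" using V by blast
    ultimately show "openin (spectrum_topology P (\<subseteq>)) (filter_at ` u)" by auto
  qed
  show "filter_at ` topspace (top_of_set X) = topspace (spectrum_topology P (\<subseteq>))"
    using spectrum_eq by simp
  show "inj_on filter_at (topspace (top_of_set X))" using inj_on_filter_at by simp
qed


subsection \<open>Edge-witnessing and star-refining subsequences\<close>

text \<open>Each edge of \<open>G m\<close> is witnessed at all large levels by a small member
  inside the intersection; there are finitely many edges, so one threshold serves them all.\<close>

lemma eventually_edge_witnessing:
  "\<exists>N. \<forall>n\<ge>N. edge_witnessing (G n) (G m) (R m n)"
proof -
  let ?E = "edges (G m)"
  have "finite ?E"
    by (rule finite_subset[of _ "C m \<times> C m"]) (auto simp: overlap_graph_def finite_cover)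
  have "\<exists>N. \<forall>n\<ge>N. \<exists>c\<in>C n. c \<subseteq> fst z \<and> c \<subseteq> snd z" if "z \<in> ?E" for z
  proof -
    have z: "fst z \<in> C m" "snd z \<in> C m" and "fst z \<inter> snd z \<noteq> {}"
      using that by (auto simp: overlap_graph_def)
    then obtain x where "x \<in> fst z \<inter> snd z" by blast
    from eventually_small_member[OF openin_Int[OF z[THEN open_member]] this]
    show ?thesis by (simp only: le_inf_iff) metis
  qed
  then have "\<forall>z\<in>?E. eventually (\<lambda>n. \<exists>c\<in>C n. c \<subseteq> fst z \<and> c \<subseteq> snd z) sequentially"
    unfolding eventually_sequentially by blast
  then have "eventually (\<lambda>n. \<forall>z\<in>?E. \<exists>c\<in>C n. c \<subseteq> fst z \<and> c \<subseteq> snd z) sequentially"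
    using \<open>finite ?E\<close> by (simp add: eventually_ball_finite)
  then obtain N where "\<forall>n\<ge>N. \<forall>z\<in>?E. \<exists>c\<in>C n. c \<subseteq> fst z \<and> c \<subseteq> snd z"
    unfolding eventually_sequentially by blast
  then show ?thesis
    by (auto simp: edge_witnessing_def containment_def overlap_graph_def intro!: exI[of _ N])
qed

text \<open>Let \<open>e\<close> be a Lebesgue number of \<open>C m\<close>. Once distances within
  members are below \<open>e / 2\<close>, the star of \<open>g\<close> lies in the ball of radius
  \<open>e\<close> about any point of \<open>g\<close>.\<close>

lemma eventually_star_refining:
  "\<exists>N. \<forall>n\<ge>N. star_refining (G n) (G m) (R m n)"
proof -
  have "open_cover (top_of_set X) (C m)"
    using open_member union_cover unfolding open_cover_def is_cover_def by auto
  then obtain e where e: "e > 0" "\<And>x. x \<in> X \<Longrightarrow> \<exists>u\<in>C m. X \<inter> ball x e \<subseteq> u"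
    using Lebesgue_number by blast
  obtain N where
    N: "\<And>n c x y. n \<ge> N \<Longrightarrow> c \<in> C n \<Longrightarrow> x \<in> c \<Longrightarrow> y \<in> c \<Longrightarrow> dist x y < e / 2"
    using fine e(1) unfolding fine_covers_def by (meson half_gt_zero)
  have "star_refining (G n) (G m) (R m n)" if n: "n \<ge> N" for n
    unfolding star_refining_def
  proof
    fix g assume "g \<in> verts (G n)"
    then have g: "g \<in> C n" by (simp add: overlap_graph_def)
    obtain x where x: "x \<in> g" using member_nonempty[OF g] by blast
    then obtain h where h: "h \<in> C m" "X \<inter> ball x e \<subseteq> h" using e(2) member_subset[OF g] by blast
    have "g' \<subseteq> X \<inter> ball x e" if g': "g' \<in> C n" "g' \<inter> g \<noteq> {}" for g'
    proof
      fix z assume z: "z \<in> g'"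
      obtain y where y: "y \<in> g'" "y \<in> g" using g' by blast
      have "dist y x < e / 2" "dist y z < e / 2" using N[OF n] g g' x y z by auto
      then have "dist x z < e" by (rule dist_triangle_half_r)
      then show "z \<in> X \<inter> ball x e" using z member_subset[OF g'(1)] by auto
    qed
    then have "{g' \<in> verts (G n). (g', g) \<in> edges (G n)} \<subseteq> rel_preimage (R m n) h"
      using h by (auto simp: rel_preimage_def containment_def overlap_graph_def)
    then show "\<exists>h\<in>verts (G m).
        {g' \<in> verts (G n). (g', g) \<in> edges (G n)} \<subseteq> rel_preimage (R m n) h"
      using h(1) by (auto simp: overlap_graph_def)
  qed
  then show ?thesis by blast
qed

end

lemma eventual_relation_subsequence:
  fixes Q :: "nat \<Rightarrow> nat \<Rightarrow> bool"
  assumes "\<And>m. \<exists>N. \<forall>n\<ge>N. Q m n"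
  obtains \<phi> :: "nat \<Rightarrow> nat" where "strict_mono \<phi>" "\<And>m n. m < n \<Longrightarrow> Q (\<phi> m) (\<phi> n)"
proof -
  obtain f where f: "\<And>m n. n \<ge> f m \<Longrightarrow> Q m n" using assms by metis
  \<comment> \<open>The summand \<open>k\<close> makes the sequence strictly increasing, and
    \<open>f k\<close> carries the next value past the threshold of \<open>k\<close>; monotonicity
    extends this to all later values.\<close>
  define \<phi> where "\<phi> = rec_nat 0 (\<lambda>_ k. Suc (k + f k))"
  have S: "\<phi> (Suc k) = Suc (\<phi> k + f (\<phi> k))" for k by (simp add: \<phi>_def)
  have mono: "strict_mono \<phi>" by (rule strict_monoI_Suc) (simp add: S)
  moreover have "Q (\<phi> m) (\<phi> n)" if "m < n" for m n
  proof (rule f)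
    have "\<phi> (Suc m) \<le> \<phi> n" using strict_mono_less_eq[OF mono] that by simp
    then show "f (\<phi> m) \<le> \<phi> n" using S[of m] by simp
  qed
  ultimately show thesis by (rule that)
qed

theorem proposition4p21:
  fixes X :: "'a::metric_space set"
    and C :: "nat \<Rightarrow> 'a set set"
    and G :: "nat \<Rightarrow> 'a set graph"
    and R :: "nat \<Rightarrow> nat \<Rightarrow> ('a set \<times> 'a set) set"
    and P :: "'a set set"
  assumes "compact X" and "X \<noteq> {}"
    and "\<And>n. open_cover (top_of_set X) (C n)"
    and "\<And>n. minimal_cover X (C n)"
    and "\<And>n. consolidates (C n) (C (Suc n))"
    and "\<And>n. C n \<inter> C (Suc n) = {}"
  defines "G \<equiv> \<lambda>n. overlap_graph (C n)"
    and "R \<equiv> \<lambda>m n. containment (C m) (C n)"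
    and "P \<equiv> \<Union>n. C n"
  shows "((\<lambda>n. Max (diameter ` C n)) \<longlonglongrightarrow> 0 \<longleftrightarrow>
            (\<forall>U. open_cover (top_of_set X) U \<longrightarrow> (\<exists>n. cover_refines (C n) U))) \<and>
         ((\<lambda>n. Max (diameter ` C n)) \<longlonglongrightarrow> 0 \<longrightarrow>
            B_sequence G R \<and> edge_faithful G R \<and> has_induced_poset G R P (\<subseteq>) \<and>
            cap_basis (top_of_set X) P \<and>
            top_of_set X homeomorphic_space spectrum_topology P (\<subseteq>) \<and>
            seq_has anti_injective G R \<and>
            (\<exists>\<phi> :: nat \<Rightarrow> nat. strict_mono \<phi> \<and>
               seq_has edge_witnessing (\<lambda>n. G (\<phi> n)) (\<lambda>m n. R (\<phi> m) (\<phi> n)) \<and>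
               seq_has star_refining (\<lambda>n. G (\<phi> n)) (\<lambda>m n. R (\<phi> m) (\<phi> n))))"
proof -
  \<comment> \<open>The mesh condition is left out here, because its equivalence with refinement has
    to be proved first.\<close>
  interpret compact_consolidating_covers X C
  proof
    show "finite (C n)" for n using minimal_cover_finite assms(1,3,4) .
    show "openin (top_of_set X) c" if "c \<in> C n" for c n
      using assms(3) that unfolding open_cover_def by blast
  qed (use assms in auto)
  have "B_sequence G R \<and> edge_faithful G R \<and> has_induced_poset G R P (\<subseteq>) \<and>
      cap_basis (top_of_set X) P \<and>
      top_of_set X homeomorphic_space spectrum_topology P (\<subseteq>) \<and>
      seq_has anti_injective G R \<and>
      (\<exists>\<phi> :: nat \<Rightarrow> nat. strict_mono \<phi> \<and>
         seq_has edge_witnessing (\<lambda>n. G (\<phi> n)) (\<lambda>m n. R (\<phi> m) (\<phi> n)) \<and>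
         seq_has star_refining (\<lambda>n. G (\<phi> n)) (\<lambda>m n. R (\<phi> m) (\<phi> n)))"
    if "fine_covers C"
  proof -
    interpret fine_compact_covers X C by unfold_locales (rule that)
    \<comment> \<open>The two properties are conjoined so that a single \<open>\<phi>\<close> serves
      both.\<close>
    have "\<exists>N. \<forall>n\<ge>N. edge_witnessing (G n) (G m) (R m n) \<and> star_refining (G n) (G m) (R m n)" for m
    proof -
      obtain N N' where "\<forall>n\<ge>N. edge_witnessing (G n) (G m) (R m n)"
          "\<forall>n\<ge>N'. star_refining (G n) (G m) (R m n)"
        using eventually_edge_witnessing eventually_star_refining unfolding G_def R_def by metis
      then show ?thesis by (intro exI[of _ "max N N'"]) auto
    qed
    then obtain \<phi> :: "nat \<Rightarrow> nat" where "strict_mono \<phi>"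
        "\<And>m n. m < n \<Longrightarrow> edge_witnessing (G (\<phi> n)) (G (\<phi> m)) (R (\<phi> m) (\<phi> n)) \<and>
           star_refining (G (\<phi> n)) (G (\<phi> m)) (R (\<phi> m) (\<phi> n))"
      using eventual_relation_subsequence
        [of "\<lambda>m n. edge_witnessing (G n) (G m) (R m n) \<and> star_refining (G n) (G m) (R m n)"]
      by blast
    then have "\<exists>\<phi> :: nat \<Rightarrow> nat. strict_mono \<phi> \<and>
         seq_has edge_witnessing (\<lambda>n. G (\<phi> n)) (\<lambda>m n. R (\<phi> m) (\<phi> n)) \<and>
         seq_has star_refining (\<lambda>n. G (\<phi> n)) (\<lambda>m n. R (\<phi> m) (\<phi> n))"
      unfolding seq_has_def by blast
    then show ?thesis
      using B_sequence_covers edge_faithful_covers has_induced_poset_covers cap_basis_covers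
        homeomorphic_map_imp_homeomorphic_space[OF homeomorphic_map_filter_at]
        seq_has_anti_injective
      unfolding G_def R_def P_def by blast
  qed
  then show ?thesis
    using fine_iff_mesh fine_iff_refines by blast
qed

end
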